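(* Fix an odd integer $c\ge 3$. For nonnegative integers $m,k$, let $G_{m,k}$ be the graph consisting of a cycle $C$ with $c$ vertices, a vertex $A$ of $C$, a vertex $B$ not on $C$ joined by an edge to $A$, and two paths attached to $B$: a path with $m$ vertices and a path with $k$ vertices, each joined to $B$ by a single edge from one of its endpoints (a path with $0$ vertices means nothing is attached), all these vertices being distinct and there being no other edges. Let $g_{m,k}$ denote the nim-value of $G_{m,k}$ in graph chomp. Then for all nonnegative integers $a,b$ and all $i,j\in\{1,2,3\}$, $$g_{3a+i,\,3b+j}=\begin{cases}4n+2 & \text{if exactly one of } i,j \text{ equals } 2,\\ 4n & \text{otherwise,}\end{cases}$$ where $n=(a\oplus b)+1$; that is, $$\begin{pmatrix}g_{3a+1,3b+1}&g_{3a+1,3b+2}&g_{3a+1,3b+3}\\ g_{3a+2,3b+1}&g_{3a+2,3b+2}&g_{3a+2,3b+3}\\ g_{3a+3,3b+1}&g_{3a+3,3b+2}&g_{3a+3,3b+3}\end{pmatrix}=\begin{pmatrix}4n&4n+2&4n\\4n+2&4n&4n+2\\4n&4n+2&4n\end{pmatrix}.$$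
   Context: $a\oplus b$ denotes the bitwise exclusive-or (nim-sum) of the binary expansions of $a$ and $b$. Graph chomp is played on a finite simple graph: two players alternate, and a move consists either of deleting one edge, or of deleting one vertex together with all edges incident to it. The player who makes the last move wins. The nim-value $g$ of a position is defined recursively: the empty graph has nim-value $0$, and $g(G)$ is the minimal nonnegative integer not equal to the nim-value of any position reachable from $G$ in one move. *)

theory Defs
  imports Main
begin

unbundle bit_operations_syntax

text \<open>A graph is a pair of a vertex set and a set of edges, each edge being a set of
  two distinct vertices.\<close>

type_synonym 'a graph = "'a set \<times> 'a set set"

definition finite_simple_graph :: "'a graph \<Rightarrow> bool" where
  "finite_simple_graph G \<longleftrightarrow>
     finite (fst G) \<and> (\<forall>e\<in>snd G. e \<subseteq> fst G \<and> card e = 2)"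

definition delete_edge :: "'a graph \<Rightarrow> 'a set \<Rightarrow> 'a graph" where
  "delete_edge G e = (fst G, snd G - {e})"

definition delete_vertex :: "'a graph \<Rightarrow> 'a \<Rightarrow> 'a graph" where
  "delete_vertex G v = (fst G - {v}, {e \<in> snd G. v \<notin> e})"

definition chomp_moves :: "'a graph \<Rightarrow> 'a graph set" where
  "chomp_moves G = delete_edge G ` snd G \<union> delete_vertex G ` fst G"

definition mex :: "nat set \<Rightarrow> nat" where
  "mex S = (LEAST n. n \<notin> S)"

lemma finite_edges:
  assumes "finite_simple_graph G"
  shows "finite (snd G)"
proof -
  have "snd G \<subseteq> Pow (fst G)"
    using assms by (auto simp: finite_simple_graph_def)
  then show ?thesis
    using assms by (meson finite_Pow_iff finite_simple_graph_def rev_finite_subset)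
qed

lemma finite_chomp_moves: "finite_simple_graph G \<Longrightarrow> finite (chomp_moves G)"
  by (simp add: chomp_moves_def finite_edges) (simp add: finite_simple_graph_def)

lemma finite_simple_graph_chomp_moves:
  "finite_simple_graph G \<Longrightarrow> H \<in> chomp_moves G \<Longrightarrow> finite_simple_graph H"
  unfolding chomp_moves_def finite_simple_graph_def delete_edge_def delete_vertex_def
  by (elim UnE imageE) (fastforce, simp, blast)

lemma chomp_moves_decreases:
  assumes G: "finite_simple_graph G" and H: "H \<in> chomp_moves G"
  shows "card (fst H) + card (snd H) < card (fst G) + card (snd G)"
proof -
  have fV: "finite (fst G)" and fE: "finite (snd G)"
    using G finite_edges[OF G] by (simp_all add: finite_simple_graph_def)
  from H consider e where "e \<in> snd G" "H = delete_edge G e"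
    | v where "v \<in> fst G" "H = delete_vertex G v"
    by (auto simp: chomp_moves_def)
  then show ?thesis
  proof cases
    case 1
    then show ?thesis
      using card_Diff1_less[OF fE, of e] by (simp add: delete_edge_def)
  next
    case 2
    have "card {e \<in> snd G. v \<notin> e} \<le> card (snd G)"
      by (rule card_mono[OF fE]) auto
    then show ?thesis
      using 2 card_Diff1_less[OF fV, of v] by (simp add: delete_vertex_def)
  qed
qed

text \<open>Positions of the game are finite simple graphs; the value \<open>0\<close> elsewhere only
  makes the function total.\<close>

function nim_value :: "'a graph \<Rightarrow> nat" where
  "nim_value G =
     (if finite_simple_graph G then mex (nim_value ` chomp_moves G) else 0)"
  by auto
termination
  by (relation "measure (\<lambda>G. card (fst G) + card (snd G))")
     (simp_all add: chomp_moves_decreases)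

declare nim_value.simps [simp del]

lemma nim_value_rec:
  "finite_simple_graph G \<Longrightarrow> nim_value G = mex (nim_value ` chomp_moves G)"
  by (subst nim_value.simps) simp

lemma nim_value_empty: "nim_value ({}, {}) = 0"
  by (subst nim_value.simps) (simp add: finite_simple_graph_def chomp_moves_def mex_def)

datatype vertex = Cyc nat | VB | P nat | Q nat

abbreviation (input) VA :: vertex where
  "VA \<equiv> Cyc 0"

text \<open>The cycle of length \<open>c\<close> has vertices \<open>Cyc 0, \<dots>, Cyc (c - 1)\<close>; the paths with \<open>m\<close> and
  \<open>k\<close> vertices have vertices \<open>P i\<close> and \<open>Q i\<close> and are joined to \<open>VB\<close> at their endpoints \<open>P 0\<close>
  and \<open>Q 0\<close>.\<close>

definition chomp_graph :: "nat \<Rightarrow> nat \<Rightarrow> nat \<Rightarrow> vertex graph" where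
  "chomp_graph c m k =
     (Cyc ` {..<c} \<union> {VB} \<union> P ` {..<m} \<union> Q ` {..<k},
      {{Cyc i, Cyc (Suc i mod c)} | i. i < c}
      \<union> {{VA, VB}}
      \<union> (if 0 < m then {{VB, P 0}} else {}) \<union> {{P i, P (Suc i)} | i. Suc i < m}
      \<union> (if 0 < k then {{VB, Q 0}} else {}) \<union> {{Q i, Q (Suc i)} | i. Suc i < k})"

lemma finite_simple_graph_chomp_graph:
  assumes "c \<ge> 3"
  shows "finite_simple_graph (chomp_graph c m k)"
proof -
  have suc_neq: "i \<noteq> Suc i mod c" if "i < c" for i
    using that assms by (cases "Suc i = c") auto
  have V: "finite (fst (chomp_graph c m k))"
    by (simp add: chomp_graph_def)
  have E: "e \<subseteq> fst (chomp_graph c m k) \<and> card e = 2"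
    if "e \<in> snd (chomp_graph c m k)" for e
    using that assms suc_neq
    by (auto simp: chomp_graph_def split: if_splits)
  show ?thesis
    unfolding finite_simple_graph_def using V E by blast
qed

end

theory Submission
  imports Defs
begin

text \<open>
  A bipartite position has nim-value \<open>(v mod 2) + 2 (e mod 2)\<close> for \<open>v\<close> vertices and \<open>e\<close> edges:
  by counting degrees, there is a vertex of even degree if \<open>v\<close> is odd, and one of odd degree if \<open>e\<close> is odd.
  An odd cycle alone has value 0.  Hence every move in \<open>G\<^bsub>m,k\<^esub>\<close> on the cycle, on \<open>AB\<close> or on
  \<open>B\<close> leads to a value below 4, and a move on an arm leads to the disjoint union of a smaller
  \<open>G\<^bsub>m',k'\<^esub>\<close> with a path, whose value is 0, 1 or 2.  This is a recurrence for \<open>g\<^bsub>m,k\<^esub>\<close> in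
  which the length of the cycle no longer occurs.

  If an arm is empty, the value is 4 for \<open>m = k = 0\<close> and 0 or 3 otherwise.  If no arm is empty,
  the options from the core and from emptying an arm are exactly \<open>0, \<dots>, 3\<close>.
  Shortening an arm into an earlier block of three gives \<open>4n'\<close> and \<open>4n' + 2\<close>, each XORed with
  1 and 2, that is, all of \<open>4n', \<dots>, 4n' + 3\<close>; so the block index follows the recursion of nim
  on two heaps, and within a block only short moves decide between \<open>4n\<close> and \<open>4n + 2\<close>.
\<close>

section \<open>Nim-sums and the recurrence\<close>

text \<open>The nim-value of a path with \<open>m\<close> vertices, the piece that a move on an arm
  cuts off.\<close>

definition tail_value :: "nat \<Rightarrow> nat" where
  "tail_value m = (if m = 0 then 0 else if odd m then 1 else 2)"

section \<open>Minimal excludants and nim-sums\<close>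

lemma mex_eqI:
  assumes "x \<notin> S" and "\<And>y. y < x \<Longrightarrow> y \<in> S"
  shows "mex S = x"
  unfolding mex_def using assms by (intro Least_equality) (auto simp: not_less[symmetric])

lemma mex_notin: "finite S \<Longrightarrow> mex S \<notin> S"
  unfolding mex_def by (rule LeastI_ex) (metis ex_new_if_finite infinite_UNIV_nat)

lemma less_mex_in: "y < mex S \<Longrightarrow> y \<in> S"
  unfolding mex_def using not_less_Least by blast

lemma xor_nat_cancel_right [simp]: "(a::nat) XOR b = a' XOR b \<longleftrightarrow> a = a'"
  by (metis xor.assoc xor.right_neutral xor_self_eq)

lemma xor_nat_cancel_left [simp]: "(b::nat) XOR a = b XOR a' \<longleftrightarrow> a = a'"
  by (metis xor.commute xor_nat_cancel_right)

text \<open>The reachability half of nim on two heaps. The induction on \<open>y\<close> strips the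
  lowest binary digit of \<open>y\<close>, \<open>a\<close> and \<open>b\<close>.\<close>

lemma less_xor_cases:
  fixes a b y :: nat
  assumes "y < a XOR b"
  shows "(\<exists>a'<a. y = a' XOR b) \<or> (\<exists>b'<b. y = a XOR b')"
  using assms
proof (induction y arbitrary: a b rule: less_induct)
  case (less y)
  have xor_div: "(p XOR q) div 2 = (p div 2) XOR (q div 2)" for p q :: nat
    by (cases "p = 0 \<or> q = 0") (auto simp: xor_nat_rec[of p q])
  have half: "\<exists>p'<p. y = p' XOR q" if p: "\<exists>p'<p div 2. y div 2 = p' XOR (q div 2)" for p q
  proof -
    obtain p' where p': "p' < p div 2" "y div 2 = p' XOR (q div 2)" using p by blast
    \<comment> \<open>The last digit of \<open>p''\<close> gives \<open>p'' XOR q\<close> the parity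
      of \<open>y\<close>. Since \<open>p' < p div 2\<close>, either choice keeps \<open>p''\<close>
      below \<open>p\<close>.\<close>
    define p'' where "p'' = 2 * p' + (if odd y = odd q then 0 else 1)"
    have "p'' XOR q = 2 * (p' XOR (q div 2)) + (if odd y then 1 else 0)"
      by (subst xor_nat_rec) (auto simp: p''_def)
    also have "\<dots> = y" unfolding p'(2)[symmetric] by (auto elim: oddE)
    finally have "y = p'' XOR q" ..
    moreover have "p'' < p" using p'(1) by (auto simp: p''_def)
    ultimately show ?thesis by blast
  qed
  have low: "\<exists>p'<p. y = p' XOR q" if "y = 2 * ((p div 2) XOR (q div 2))" "odd p" "even q" for p q
  proof -
    have "(p - 1) XOR q = y" using that
      by (subst xor_nat_rec) (auto elim!: oddE)
    moreover have "p - 1 < p" using that by (cases p) auto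
    ultimately show ?thesis by metis
  qed
  show ?case
  proof (cases "y div 2 < (a div 2) XOR (b div 2)")
    case True
    \<comment> \<open>Halving does not decrease \<open>y = 0\<close>; in that case the larger
      summand is lowered to the smaller one instead.\<close>
    have "y div 2 < y \<or> y = 0" by auto
    then show ?thesis
    proof
      assume "y div 2 < y"
      from less.IH[OF this True] show ?thesis
        using half[of a b] half[of b a] by (metis xor.commute)
    next
      assume y: "y = 0"
      show ?thesis
      proof (cases a b rule: linorder_cases)
        case less then show ?thesis using y by (intro disjI2 exI[of _ a]) auto
      next
        case equal then show ?thesis using \<open>y < a XOR b\<close> by auto
      next
        case greater then show ?thesis using y by (intro disjI1 exI[of _ b]) auto
      qed
    qed
  next
    case False
    \<comment> \<open>The halves of \<open>y\<close> and of the nim-sum now agree, so the two differ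
      in the last digit only. Exactly one summand is odd, and it is lowered by 1.\<close>
    have ab: "a XOR b = 2 * ((a div 2) XOR (b div 2)) + of_bool (odd a \<noteq> odd b)"
      by (subst xor_nat_rec) auto
    then have "odd a \<noteq> odd b" and "y = 2 * ((a div 2) XOR (b div 2))"
      using less.prems False by (auto simp: of_bool_def split: if_splits)
    then show ?thesis using low[of a b] low[of b a] by (auto simp: xor.commute)
  qed
qed

lemma nat_less_4: "(r::nat) < 4 \<longleftrightarrow> r = 0 \<or> r = 1 \<or> r = 2 \<or> r = 3"
  by auto

text \<open>Nim-sums act digit by digit, so \<open>s < 4\<close> cannot reach the digits that encode
  \<open>4 * n\<close>. The proof splits off one binary digit at a time.\<close>

lemma xor_low_bits:
  fixes n r s :: nat
  assumes "r < 4" "s < 4"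
  shows "(4 * n + r) XOR s = 4 * n + (r XOR s)"
proof -
  have "(2 * n + u) XOR v = 2 * n + (u XOR v)" if "u < 2" "v < 2" for u v
    using that by (subst xor_nat_rec) (auto simp: less_2_cases_iff)
  moreover have "(4 * n + r) div 2 = 2 * n + r div 2" by presburger
  moreover have "r div 2 < 2" "s div 2 < 2" using assms by auto
  ultimately have "((4 * n + r) div 2) XOR (s div 2) = 2 * n + (r div 2 XOR s div 2)" by simp
  then show ?thesis by (subst (1 2) xor_nat_rec) simp
qed

text \<open>\<open>block_value x y\<close> is the nim-value for arms with \<open>Suc x\<close> and \<open>Suc y\<close> vertices; the shift
  by one turns the index ranges \<open>3a + 1, \<dots>, 3a + 3\<close> into the residue classes of division by 3.\<close>

definition block_value :: "nat \<Rightarrow> nat \<Rightarrow> nat" where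
  "block_value x y = 4 * ((x div 3 XOR y div 3) + 1)
     + (if (x mod 3 = 1) \<noteq> (y mod 3 = 1) then 2 else 0)"

lemma block_value_commute: "block_value x y = block_value y x"
  by (auto simp: block_value_def xor.commute)

section \<open>Options from shortening one arm\<close>

lemma tail_value_less: "tail_value m < 4" by (simp add: tail_value_def)

lemma block_value_xor:
  "s < 4 \<Longrightarrow> block_value x y XOR s = 4 * ((x div 3 XOR y div 3) + 1)
     + ((if (x mod 3 = 1) \<noteq> (y mod 3 = 1) then 2 else 0) XOR s)"
  unfolding block_value_def by (rule xor_low_bits) auto

lemma xor_less_4: "r < 4 \<Longrightarrow> s < 4 \<Longrightarrow> r XOR s < (4::nat)"
  by (auto simp: nat_less_4)

text \<open>When \<open>u\<close> vertices stay attached, deleting an edge cuts off a path with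
  \<open>x - u\<close> vertices and deleting a vertex one with \<open>x - u - 1\<close>;
  \<open>f u\<close> is the value of the rest. Only differences of lengths enter, so
  \<open>f\<close> may also be indexed by lengths shifted by one.\<close>

definition arm_values :: "(nat \<Rightarrow> nat) \<Rightarrow> nat \<Rightarrow> nat set" where
  "arm_values f x = (\<Union>u<x. {f u XOR tail_value (x - u), f u XOR tail_value (x - u - 1)})"

lemma arm_values_eq_image:
  "arm_values f m = (\<lambda>u. f u XOR tail_value (m - u)) ` {..<m}
     \<union> (\<lambda>u. f u XOR tail_value (m - u - 1)) ` {..<m}"
  by (auto simp: arm_values_def)

text \<open>Since \<open>s\<close> changes only the two low digits, equality would put
  \<open>u\<close> and \<open>x\<close> in the same block of three. At distance 1 exactly one of
  them is in the middle, which would force \<open>s = 2\<close>; at distance 2 neither is, which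
  would force \<open>s = 0\<close>. The tails at these distances do not have these values.\<close>

lemma block_value_notin_arm_values:
  "block_value x y \<notin> arm_values (\<lambda>u. block_value u y) x"
proof
  assume "block_value x y \<in> arm_values (\<lambda>u. block_value u y) x"
  then obtain u s where u: "u < x" and s: "s = tail_value (x - u) \<or> s = tail_value (x - u - 1)"
    and eq: "block_value x y = block_value u y XOR s"
    by (auto simp: arm_values_def)
  have s4: "s < 4" using s tail_value_less by auto
  define r where "r = (\<lambda>v :: nat. if (v mod 3 = 1) \<noteq> (y mod 3 = 1) then 2 else 0 :: nat)"
  have "4 * ((x div 3 XOR y div 3) + 1) + r x = 4 * ((u div 3 XOR y div 3) + 1) + (r u XOR s)"
    using eq unfolding block_value_xor[OF s4] by (simp add: block_value_def r_def)
  moreover have "r x < 4" "r u XOR s < 4" using s4 by (auto simp: r_def intro!: xor_less_4)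
  moreover have "p = q \<and> v = w" if "4 * (p + 1) + v = 4 * (q + 1) + w" "v < 4" "w < 4" for p q v w :: nat
    using that by presburger
  ultimately have "x div 3 XOR y div 3 = u div 3 XOR y div 3" and r: "r x = r u XOR s"
    by blast+
  then have "x div 3 = u div 3" by simp
  then have "x = 3 * (u div 3) + x mod 3" "u = 3 * (u div 3) + u mod 3"
    by (metis mult_div_mod_eq)+
  then have "u mod 3 < x mod 3" "x - u = x mod 3 - u mod 3" using u by linarith+
  moreover have "x mod 3 = 0 \<or> x mod 3 = 1 \<or> x mod 3 = 2" by linarith
  ultimately have "(x mod 3 = 1) \<noteq> (u mod 3 = 1) \<and> x - u = 1 \<or> (x mod 3 = 1) = (u mod 3 = 1) \<and> x - u = 2"
    by auto
  then show False
  proof (elim disjE conjE)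
    assume "(x mod 3 = 1) \<noteq> (u mod 3 = 1)" "x - u = 1"
    moreover from this have "s = 0 \<or> s = 1" using s by (auto simp: tail_value_def)
    ultimately show False using r by (cases "y mod 3 = 1"; cases "u mod 3 = 1") (auto simp: r_def)
  next
    assume "(x mod 3 = 1) = (u mod 3 = 1)" "x - u = 2"
    moreover from this have "s = 1 \<or> s = 2" using s by (auto simp: tail_value_def)
    ultimately show False using r by (cases "y mod 3 = 1"; cases "u mod 3 = 1") (auto simp: r_def)
  qed
qed

text \<open>The indices \<open>3 * a\<close> and \<open>3 * a + 1\<close> have low parts 0 and 2 in
  some order, and XOR with 1 and 2 yields all four remainders. For both, \<open>x - u\<close> and
  \<open>x - u - 1\<close> are positive and of opposite parity, so tails of value 1 and of value 2
  occur.\<close>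

lemma block_in_arm_values:
  assumes a: "a < x div 3" and r: "r < 4"
  shows "4 * ((a XOR y div 3) + 1) + r \<in> arm_values (\<lambda>u. block_value u y) x"
proof -
  have opt: "block_value u y XOR s \<in> arm_values (\<lambda>u. block_value u y) x"
    if "u = 3 * a \<or> u = 3 * a + 1" "s = 1 \<or> s = 2" for u s
  proof -
    have "u < x" "x - u \<ge> 2" using a that by auto
    then have "s = tail_value (x - u) \<or> s = tail_value (x - u - 1)"
      using that(2) by (auto simp: tail_value_def)
    then show ?thesis using \<open>u < x\<close> unfolding arm_values_def by blast
  qed
  have "(3 * a + 1) div 3 = a" "(3 * a + 1) mod 3 = 1" by presburger+
  then show ?thesis
    using opt[of "3 * a" 1] opt[of "3 * a" 2] opt[of "3 * a + 1" 1] opt[of "3 * a + 1" 2] r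
    by (cases "y mod 3 = 1") (auto simp: block_value_xor nat_less_4)
qed

text \<open>Supplies the values \<open>4 * n\<close> and \<open>4 * n + 1\<close> needed below
  \<open>4 * n + 2\<close>. Only the last vertex of the arm is affected: deleting its edge leaves a
  tail of value 1, deleting the vertex leaves none.\<close>

lemma lower_half_in_arm_values:
  assumes "x mod 3 = 1" "y mod 3 \<noteq> 1" "r < 2"
  shows "4 * ((x div 3 XOR y div 3) + 1) + r \<in> arm_values (\<lambda>u. block_value u y) x"
proof -
  have x: "x - 1 < x" "x - (x - 1) = 1" "(x - 1) div 3 = x div 3" "(x - 1) mod 3 = 0"
    using assms(1) by presburger+
  have "block_value (x - 1) y XOR r \<in> arm_values (\<lambda>u. block_value u y) x"
    unfolding arm_values_def using assms(3) x(1,2)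
    by (intro UN_I[of "x - 1"]) (auto simp: tail_value_def less_2_cases_iff)
  then show ?thesis using assms x by (simp add: block_value_xor)
qed

text \<open>The set \<open>{..<4}\<close> stands for the core moves together with the moves that
  empty an arm.\<close>

lemma mex_block_value:
  "mex ({..<4} \<union> arm_values (\<lambda>u. block_value u y) x \<union> arm_values (block_value x) y)
     = block_value x y"
proof (rule mex_eqI)
  show "block_value x y \<notin> {..<4} \<union> arm_values (\<lambda>u. block_value u y) x \<union> arm_values (block_value x) y"
    using block_value_notin_arm_values[of x y] block_value_notin_arm_values[of y x]
    by (simp add: block_value_commute[of _ x]) (simp add: block_value_def)
next
  fix w assume w: "w < block_value x y"
  \<comment> \<open>The subtraction undoes the \<open>+ 1\<close> in \<open>block_value\<close>, so
    that \<open>N\<close> is compared with a nim-sum of block indices.\<close>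
  define N r where "N = w div 4 - 1" and "r = w mod 4"
  show "w \<in> {..<4} \<union> arm_values (\<lambda>u. block_value u y) x \<union> arm_values (block_value x) y"
  proof (cases "w < 4")
    case False
    then have w_eq: "w = 4 * (N + 1) + r" and r: "r < 4" by (auto simp: N_def r_def)
    have sym: "block_value x = (\<lambda>u. block_value u x)" by (auto simp: block_value_commute)
    \<comment> \<open>Either the block index drops, which a move of two-heap nim realises for every
      \<open>r\<close>, or only the lower half of the current block is in question; then the arm
      whose index is in the middle is shortened by one.\<close>
    from w w_eq have "N < x div 3 XOR y div 3 \<or> N = x div 3 XOR y div 3 \<and> r < 2 \<and> (x mod 3 = 1) \<noteq> (y mod 3 = 1)"
      by (auto simp: block_value_def split: if_splits)
    then show ?thesis
    proof
      assume "N < x div 3 XOR y div 3"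
      from less_xor_cases[OF this] show ?thesis
      proof (elim disjE exE conjE)
        fix a assume "a < x div 3" "N = a XOR y div 3"
        then show ?thesis using block_in_arm_values[OF _ r] w_eq by auto
      next
        fix b assume "b < y div 3" "N = x div 3 XOR b"
        then show ?thesis using block_in_arm_values[OF _ r, of b y x] w_eq
          by (auto simp: sym xor.commute)
      qed
    next
      assume "N = x div 3 XOR y div 3 \<and> r < 2 \<and> (x mod 3 = 1) \<noteq> (y mod 3 = 1)"
      then show ?thesis
        using lower_half_in_arm_values[of x y r] lower_half_in_arm_values[of y x r] w_eq
        by (auto simp: sym xor.commute)
    qed
  qed simp
qed

section \<open>Solving the recurrence\<close>

lemma arm_values_Suc:
  "arm_values f (Suc x) = {f 0 XOR tail_value (Suc x), f 0 XOR tail_value x}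
     \<union> arm_values (\<lambda>u. f (Suc u)) x"
  unfolding arm_values_def lessThan_Suc_eq_insert_0 by simp

lemma arm_values_cong:
  "(\<And>u. u < x \<Longrightarrow> f u = g u) \<Longrightarrow> arm_values f x = arm_values g x"
  by (simp add: arm_values_def)

text \<open>Deleting a cycle edge and deleting a cycle vertex other than \<open>VA\<close> give 1
  and 2, in an order fixed by the parity of \<open>m + k\<close>. \<open>VA\<close> gives the third
  value and \<open>VB\<close> the last; the edge between them repeats 1 or 2.\<close>

definition core_values :: "nat \<Rightarrow> nat \<Rightarrow> nat set" where
  "core_values m k = {1, 2, if even (m + k) then 3 else 0, tail_value m XOR tail_value k}"

text \<open>The case of one empty arm. The core supplies 0, 1, 2 for odd \<open>x\<close>, and 1, 2,
  3 without 0 for even \<open>x\<close>; the arm only has to avoid the claimed value.\<close>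

lemma mex_end_value:
  assumes "x \<noteq> 0"
  shows "mex (core_values 0 x \<union> arm_values (\<lambda>u. if u = 0 then 4 else if odd u then 3 else 0) x)
    = (if odd x then 3 else 0)"
proof -
  define f :: "nat \<Rightarrow> nat" where "f u = (if u = 0 then 4 else if odd u then 3 else 0)" for u
  have "f u XOR s \<noteq> (if odd x then 3 else 0)"
    if "u < x" "s = tail_value (x - u) \<or> s = tail_value (x - u - 1)" for u s
  proof (cases "x = Suc u")
    case True
    then have "s = 0 \<or> s = 1" using that by (auto simp: tail_value_def)
    then show ?thesis using True by (auto simp: f_def)
  next
    case False
    then have "x - u \<noteq> 0" "x - u - 1 \<noteq> 0" using that by auto
    \<comment> \<open>XORing 0, 3 or 4 with 1 or 2 gives 1, 2, 5 or 6, hence neither 0 nor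
      3.\<close>
    then have "s = 1 \<or> s = 2" using that(2) unfolding tail_value_def by metis
    then show ?thesis by (auto simp: f_def)
  qed
  then have "(if odd x then 3 else 0) \<notin> arm_values f x"
    by (force simp: arm_values_def)
  moreover have "core_values 0 x = (if odd x then {0, 1, 2} else {1, 2, 3})"
    using assms by (auto simp: core_values_def tail_value_def)
  ultimately have "mex (core_values 0 x \<union> arm_values f x) = (if odd x then 3 else 0)"
    by (intro mex_eqI) (auto split: if_splits)
  then show ?thesis unfolding f_def .
qed

text \<open>The cases \<open>f 0 k\<close> and \<open>f k 0\<close> are solved first, since the
  block formula covers nonempty arms only.\<close>

lemma recurrence_solution:
  fixes f :: "nat \<Rightarrow> nat \<Rightarrow> nat"
  assumes rec: "\<And>m k. f m k =
    mex (core_values m k \<union> arm_values (\<lambda>u. f u k) m \<union> arm_values (f m) k)"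
  shows "f (Suc x) (Suc y) = block_value x y"
proof -
  have core: "core_values m k = {..<4}" if "m \<noteq> 0" "k \<noteq> 0" for m k
    using that by (auto simp: core_values_def tail_value_def nat_less_4)
  have arm0: "arm_values g 0 = {}" for g by (simp add: arm_values_def)
  have "f 0 0 = 4"
    by (subst rec, rule mex_eqI) (auto simp: arm0 core_values_def tail_value_def nat_less_4)
  then have left: "f 0 k = (if k = 0 then 4 else if odd k then 3 else 0)" for k
  proof (induction k rule: less_induct)
    case (less k)
    show ?case
    proof (cases "k = 0")
      case False
      have "f 0 k = mex (core_values 0 k \<union> arm_values (f 0) k)"
        by (subst rec) (simp add: arm0)
      also have "arm_values (f 0) k = arm_values (\<lambda>u. if u = 0 then 4 else if odd u then 3 else 0) k"
        using less by (intro arm_values_cong) auto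
      finally show ?thesis using mex_end_value[OF False] False by simp
    qed (use less.prems in simp)
  qed
  have right: "f k 0 = (if k = 0 then 4 else if odd k then 3 else 0)" for k
  proof (induction k rule: less_induct)
    case (less k)
    show ?case
    proof (cases "k = 0")
      case False
      have "core_values k 0 = core_values 0 k" by (simp add: core_values_def xor.commute)
      then have "f k 0 = mex (core_values 0 k \<union> arm_values (\<lambda>u. f u 0) k)"
        by (subst rec) (simp add: arm0)
      also have "arm_values (\<lambda>u. f u 0) k = arm_values (\<lambda>u. if u = 0 then 4 else if odd u then 3 else 0) k"
        using less by (intro arm_values_cong) auto
      finally show ?thesis using mex_end_value[OF False] False by simp
    qed (simp add: \<open>f 0 0 = 4\<close>)
  qed
  \<comment> \<open>Emptying one of two nonempty arms leaves the other nonempty, so the exceptional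
    value 4 does not occur. These options, split off by \<open>arm_values_Suc\<close>, add nothing
    to the core values.\<close>
  have "f 0 (Suc v) < 4" "f (Suc v) 0 < 4" for v by (simp_all add: left right)
  then have ends: "{f 0 (Suc v) XOR tail_value n, f 0 (Suc v) XOR tail_value n'} \<subseteq> {..<4}"
    "{f (Suc v) 0 XOR tail_value n, f (Suc v) 0 XOR tail_value n'} \<subseteq> {..<4}" for v n n'
    by (auto intro: xor_less_4 tail_value_less)
  show ?thesis
  proof (induction "x + y" arbitrary: x y rule: less_induct)
    case less
    have IH: "arm_values (\<lambda>u. f (Suc u) (Suc y)) x = arm_values (\<lambda>u. block_value u y) x"
      "arm_values (\<lambda>u. f (Suc x) (Suc u)) y = arm_values (block_value x) y"
      by (intro arm_values_cong less; simp)+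
    have "core_values (Suc x) (Suc y) \<union> arm_values (\<lambda>u. f u (Suc y)) (Suc x)
        \<union> arm_values (f (Suc x)) (Suc y)
      = {..<4} \<union> arm_values (\<lambda>u. block_value u y) x \<union> arm_values (block_value x) y"
      unfolding arm_values_Suc IH using core[of "Suc x" "Suc y"] ends(1)[of y "Suc x" x] ends(2)[of x "Suc y" y]
      by auto
    then show ?case by (subst rec) (simp add: mex_block_value)
  qed
qed

section \<open>Disjoint unions and bipartite graphs\<close>

definition graph_union :: "'a graph \<Rightarrow> 'a graph \<Rightarrow> 'a graph" where
  "graph_union G H = (fst G \<union> fst H, snd G \<union> snd H)"

lemma graph_union_commute: "graph_union G H = graph_union H G"
  by (auto simp: graph_union_def)

lemma finite_simple_graph_union:
  "finite_simple_graph G \<Longrightarrow> finite_simple_graph H \<Longrightarrow> finite_simple_graph (graph_union G H)"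
  unfolding finite_simple_graph_def graph_union_def by auto

lemma fst_chomp_moves: "G' \<in> chomp_moves G \<Longrightarrow> fst G' \<subseteq> fst G"
  by (auto simp: chomp_moves_def delete_edge_def delete_vertex_def)

lemma finite_simple_graph_edgeE:
  assumes "finite_simple_graph G" "e \<in> snd G"
  obtains x y where "e = {x, y}" "x \<noteq> y" "x \<in> fst G" "y \<in> fst G"
  using assms unfolding finite_simple_graph_def by (metis card_2_iff insert_subset)

lemma delete_graph_union:
  assumes "finite_simple_graph G" "finite_simple_graph H" "fst G \<inter> fst H = {}"
  shows "e \<in> snd G \<Longrightarrow> delete_edge (graph_union G H) e = graph_union (delete_edge G e) H"
    and "v \<in> fst G \<Longrightarrow> delete_vertex (graph_union G H) v = graph_union (delete_vertex G v) H"
proof -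
  have "e \<notin> snd H" if "e \<in> snd G" for e
    using that assms by (metis disjoint_iff finite_simple_graph_edgeE insertI1 doubleton_eq_iff)
  then show "e \<in> snd G \<Longrightarrow> delete_edge (graph_union G H) e = graph_union (delete_edge G e) H"
    by (auto simp: delete_edge_def graph_union_def)
  assume v: "v \<in> fst G"
  then have "v \<notin> fst H" "v \<notin> e" if "e \<in> snd H" for e
    using that assms unfolding finite_simple_graph_def by blast+
  moreover have "v \<notin> fst H" using v assms(3) by blast
  ultimately show "delete_vertex (graph_union G H) v = graph_union (delete_vertex G v) H"
    by (auto simp: delete_vertex_def graph_union_def)
qed

lemma chomp_moves_graph_union:
  assumes "finite_simple_graph G" "finite_simple_graph H" "fst G \<inter> fst H = {}"
  shows "chomp_moves (graph_union G H) =
    (\<lambda>G'. graph_union G' H) ` chomp_moves G \<union> graph_union G ` chomp_moves H"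
proof -
  have HG: "fst H \<inter> fst G = {}" using assms(3) by blast
  have "snd (graph_union G H) = snd G \<union> snd H" "fst (graph_union G H) = fst G \<union> fst H"
    by (simp_all add: graph_union_def)
  then show ?thesis
    using delete_graph_union[OF assms] delete_graph_union[OF assms(2,1) HG]
    by (simp add: chomp_moves_def image_Un image_image graph_union_commute[of H] graph_union_commute[of _ G]
        Un_ac cong: image_cong)
qed

text \<open>The Sprague-Grundy principle: a move changes one component, so each option replaces one
  term of the nim-sum. Cancellation excludes the value itself, and \<open>less_xor_cases\<close>
  reaches every smaller one.\<close>

lemma nim_value_graph_union:
  assumes "finite_simple_graph G" "finite_simple_graph H" "fst G \<inter> fst H = {}"
  shows "nim_value (graph_union G H) = nim_value G XOR nim_value H"
  using assms
proof (induction "card (fst G) + card (snd G) + (card (fst H) + card (snd H))" arbitrary: G H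
    rule: less_induct)
  case less
  note G = less.prems(1) and H = less.prems(2)
  have IH1: "nim_value (graph_union G' H) = nim_value G' XOR nim_value H" if "G' \<in> chomp_moves G" for G'
    using that less.prems fst_chomp_moves[OF that] chomp_moves_decreases[OF G that]
      finite_simple_graph_chomp_moves[OF G that]
    by (intro less.hyps) auto
  have IH2: "nim_value (graph_union G H') = nim_value G XOR nim_value H'" if "H' \<in> chomp_moves H" for H'
    using that less.prems fst_chomp_moves[OF that] chomp_moves_decreases[OF H that]
      finite_simple_graph_chomp_moves[OF H that]
    by (intro less.hyps) auto
  have options: "nim_value ` chomp_moves (graph_union G H) =
      (\<lambda>g. g XOR nim_value H) ` nim_value ` chomp_moves G
      \<union> (\<lambda>h. nim_value G XOR h) ` nim_value ` chomp_moves H"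
    unfolding chomp_moves_graph_union[OF less.prems] image_Un image_image
    using IH1 IH2 by (simp cong: image_cong)
  have "mex (nim_value ` chomp_moves (graph_union G H)) = nim_value G XOR nim_value H"
  proof (rule mex_eqI)
    have "nim_value G \<notin> nim_value ` chomp_moves G" "nim_value H \<notin> nim_value ` chomp_moves H"
      by (metis nim_value_rec mex_notin finite_imageI finite_chomp_moves G)
         (metis nim_value_rec mex_notin finite_imageI finite_chomp_moves H)
    then show "nim_value G XOR nim_value H \<notin> nim_value ` chomp_moves (graph_union G H)"
      unfolding options by auto
  next
    fix y assume "y < nim_value G XOR nim_value H"
    from less_xor_cases[OF this] show "y \<in> nim_value ` chomp_moves (graph_union G H)"
      unfolding options using less_mex_in nim_value_rec G H by (metis UnI1 UnI2 imageI)
  qed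
  then show ?case
    using nim_value_rec finite_simple_graph_union G H by metis
qed

text \<open>Bipartiteness is expressed by a set \<open>A\<close> that separates the ends of every
  edge. As \<open>A\<close> is not tied to the vertex set, the same set serves all
  subgraphs.\<close>

definition crosses :: "'a set \<Rightarrow> 'a set \<Rightarrow> bool" where
  "crosses A e \<longleftrightarrow> (\<exists>x y. e = {x, y} \<and> x \<in> A \<and> y \<notin> A)"

lemma crosses_pair [simp]: "crosses A {x, y} \<longleftrightarrow> (x \<in> A) \<noteq> (y \<in> A)"
  unfolding crosses_def by (auto simp: doubleton_eq_iff)

definition degree :: "'a graph \<Rightarrow> 'a \<Rightarrow> nat" where
  "degree G v = card {e \<in> snd G. v \<in> e}"

definition parity_value :: "'a graph \<Rightarrow> nat" where
  "parity_value G = card (fst G) mod 2 + 2 * (card (snd G) mod 2)"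

text \<open>Double counting of incidences, for \<open>A\<close> the whole vertex set or one side of
  a bipartition.\<close>

lemma sum_degree:
  assumes "finite A" "finite (snd G)"
  shows "(\<Sum>v\<in>A. degree G v) = (\<Sum>e\<in>snd G. card (e \<inter> A))"
proof -
  have "(\<Sum>v\<in>A. degree G v) = (\<Sum>v\<in>A. \<Sum>e\<in>snd G. if v \<in> e then 1 else 0)"
    using assms by (simp add: degree_def sum.If_cases Int_def)
  also have "\<dots> = (\<Sum>e\<in>snd G. \<Sum>v\<in>A. if v \<in> e then 1 else 0)"
    by (rule sum.swap)
  also have "\<dots> = (\<Sum>e\<in>snd G. card (e \<inter> A))"
    using assms by (simp add: sum.If_cases Int_def conj_commute)
  finally show ?thesis .
qed

text \<open>An odd number of odd degrees would have an odd sum, but the sum is twice the number of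
  edges.\<close>

lemma ex_even_degree:
  assumes "finite_simple_graph G" "odd (card (fst G))"
  shows "\<exists>v\<in>fst G. even (degree G v)"
proof (rule ccontr)
  assume odd: "\<not> (\<exists>v\<in>fst G. even (degree G v))"
  have fin: "finite (fst G)" "finite (snd G)"
    using assms(1) finite_edges[OF assms(1)] by (simp_all add: finite_simple_graph_def)
  have "card (e \<inter> fst G) = 2" if "e \<in> snd G" for e
    using that assms(1) by (auto simp: finite_simple_graph_def Int_absorb2)
  then have "(\<Sum>v\<in>fst G. degree G v) = 2 * card (snd G)"
    by (simp add: sum_degree[OF fin])
  moreover have "even (\<Sum>v\<in>fst G. degree G v) \<longleftrightarrow> even (card {v \<in> fst G. odd (degree G v)})"
    by (rule even_sum_iff[OF fin(1)])
  moreover have "{v \<in> fst G. odd (degree G v)} = fst G" using odd by auto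
  ultimately show False using assms(2) by simp
qed

text \<open>Each edge has exactly one end in \<open>A\<close>, so the degrees there sum to the odd
  number of edges.\<close>

lemma ex_odd_degree:
  assumes "finite_simple_graph G" "\<forall>e\<in>snd G. crosses A e" "odd (card (snd G))"
  shows "\<exists>v\<in>fst G. odd (degree G v)"
proof (rule ccontr)
  assume even: "\<not> (\<exists>v\<in>fst G. odd (degree G v))"
  have fin: "finite (fst G)" "finite (snd G)"
    using assms(1) finite_edges[OF assms(1)] by (simp_all add: finite_simple_graph_def)
  have "card (e \<inter> (A \<inter> fst G)) = 1" if "e \<in> snd G" for e
  proof -
    have "crosses A e" using that assms(2) by blast
    then obtain x y where "e = {x, y}" "x \<in> A" "y \<notin> A" unfolding crosses_def by blast
    moreover from this have "x \<in> fst G" using that assms(1) by (auto simp: finite_simple_graph_def)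
    ultimately have "e \<inter> (A \<inter> fst G) = {x}" by auto
    then show ?thesis by simp
  qed
  then have "(\<Sum>v\<in>A \<inter> fst G. degree G v) = card (snd G)"
    using fin by (simp add: sum_degree)
  moreover have "even (\<Sum>v\<in>A \<inter> fst G. degree G v)"
    using even by (intro dvd_sum) auto
  ultimately show False using assms(3) by simp
qed

lemma card_delete_edge:
  assumes "finite_simple_graph G" "e \<in> snd G"
  shows "card (fst (delete_edge G e)) = card (fst G)"
    "Suc (card (snd (delete_edge G e))) = card (snd G)"
  using assms finite_edges[OF assms(1)] by (simp_all add: delete_edge_def card_Suc_Diff1 del: card_Diff_insert)

lemma card_delete_vertex:
  assumes "finite_simple_graph G" "v \<in> fst G"
  shows "Suc (card (fst (delete_vertex G v))) = card (fst G)"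
    "card (snd (delete_vertex G v)) + degree G v = card (snd G)"
proof -
  show "Suc (card (fst (delete_vertex G v))) = card (fst G)"
    using assms by (simp add: delete_vertex_def finite_simple_graph_def card_Suc_Diff1 del: card_Diff_insert)
  have "card {e \<in> snd G. v \<notin> e} + card {e \<in> snd G. v \<in> e} = card ({e \<in> snd G. v \<notin> e} \<union> {e \<in> snd G. v \<in> e})"
    using finite_edges[OF assms(1)] by (intro card_Un_disjoint[symmetric]) auto
  also have "{e \<in> snd G. v \<notin> e} \<union> {e \<in> snd G. v \<in> e} = snd G" by auto
  finally show "card (snd (delete_vertex G v)) + degree G v = card (snd G)"
    by (simp add: delete_vertex_def degree_def)
qed

lemma parity_delete_edge:
  assumes "finite_simple_graph G" "e \<in> snd G"
  shows "even (card (fst (delete_edge G e))) \<longleftrightarrow> even (card (fst G))"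
    "even (card (snd (delete_edge G e))) \<longleftrightarrow> odd (card (snd G))"
  using card_delete_edge[OF assms] by (metis even_Suc)+

lemma parity_delete_vertex:
  assumes "finite_simple_graph G" "v \<in> fst G"
  shows "even (card (fst (delete_vertex G v))) \<longleftrightarrow> odd (card (fst G))"
    "even (card (snd (delete_vertex G v))) \<longleftrightarrow> (even (card (snd G)) \<longleftrightarrow> even (degree G v))"
  using card_delete_vertex[OF assms] by (metis even_Suc, metis even_add)

text \<open>Deleting an edge flips only the edge parity, and deleting a vertex flips the vertex
  parity, so no move preserves the value.\<close>

lemma nim_value_bipartite:
  assumes "finite_simple_graph G" "\<forall>e\<in>snd G. crosses A e"
  shows "nim_value G = parity_value G"
  using assms
proof (induction "card (fst G) + card (snd G)" arbitrary: G rule: less_induct)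
  case less
  note G = less.prems(1)
  have IH: "nim_value H = parity_value H" if "H \<in> chomp_moves G" for H
  proof (rule less.hyps)
    show "\<forall>e\<in>snd H. crosses A e"
      using that less.prems(2) by (auto simp: chomp_moves_def delete_edge_def delete_vertex_def)
  qed (use that chomp_moves_decreases[OF G] finite_simple_graph_chomp_moves[OF G] in auto)
  define S where "S = nim_value ` chomp_moves G"
  have edge: "card (fst G) mod 2 \<in> S"
    if "odd (card (snd G))"
  proof -
    from that obtain e where e: "e \<in> snd G" by fastforce
    then have "delete_edge G e \<in> chomp_moves G" by (auto simp: chomp_moves_def)
    then have "parity_value (delete_edge G e) \<in> S" using IH unfolding S_def by (metis imageI)
    then show ?thesis
      using parity_delete_edge[OF G e] that by (simp add: parity_value_def mod_2_eq_odd)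
  qed
  have vertex: "parity_value (delete_vertex G v) \<in> S" if "v \<in> fst G" for v
  proof -
    have "delete_vertex G v \<in> chomp_moves G" using that by (auto simp: chomp_moves_def)
    then show ?thesis using IH unfolding S_def by (metis imageI)
  qed
  have even_vertex: "2 * (card (snd G) mod 2) \<in> S" if "odd (card (fst G))"
  proof -
    from ex_even_degree[OF G that] obtain v where v: "v \<in> fst G" "even (degree G v)" by blast
    note deleted = parity_delete_vertex[OF G v(1)]
    have "parity_value (delete_vertex G v) = 2 * (card (snd G) mod 2)"
      using deleted v(2) that by (simp add: parity_value_def mod_2_eq_odd)
    then show ?thesis using vertex[OF v(1)] by simp
  qed
  have odd_vertex: "1 - card (fst G) mod 2 \<in> S" if "odd (card (snd G))"
  proof -
    from ex_odd_degree[OF less.prems that] obtain v where v: "v \<in> fst G" "odd (degree G v)" by blast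
    note deleted = parity_delete_vertex[OF G v(1)]
    have "parity_value (delete_vertex G v) = 1 - card (fst G) mod 2"
      using deleted v(2) that by (simp add: parity_value_def mod_2_eq_odd)
    then show ?thesis using vertex[OF v(1)] by simp
  qed
  have "mex S = parity_value G"
  proof (rule mex_eqI)
    have "parity_value G \<noteq> parity_value H" if "H \<in> chomp_moves G" for H
    proof -
      from that consider e where "e \<in> snd G" "H = delete_edge G e"
        | v where "v \<in> fst G" "H = delete_vertex G v"
        by (auto simp: chomp_moves_def)
      then show ?thesis
      proof cases
        case 1
        then show ?thesis using parity_delete_edge[OF G 1(1)] by (auto simp: parity_value_def mod_2_eq_odd)
      next
        case 2
        then show ?thesis using parity_delete_vertex(1)[OF G 2(1)] by (auto simp: parity_value_def mod_2_eq_odd split: if_splits)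
      qed
    qed
    then show "parity_value G \<notin> S" unfolding S_def using IH by auto
  next
    \<comment> \<open>Where the parities allow them, deleting an edge lowers the value by 2, a
      vertex of even degree lowers it by 1, and a vertex of odd degree leads from 3 to 0 or from 2
      to 1.\<close>
    fix y assume y: "y < parity_value G"
    then have "y = 0 \<or> y = 1 \<or> y = 2" unfolding parity_value_def by linarith
    with y show "y \<in> S"
      using edge even_vertex odd_vertex
      by (cases "odd (card (fst G))"; cases "odd (card (snd G))")
         (auto simp: parity_value_def mod_2_eq_odd)
  qed
  then show ?case using nim_value_rec[OF G] by (simp add: S_def)
qed

section \<open>Cycles with two arms\<close>

definition cycle_edge :: "nat \<Rightarrow> nat \<Rightarrow> vertex set" where
  "cycle_edge c i = {Cyc i, Cyc (Suc i mod c)}"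

text \<open>Edge \<open>i\<close> joins vertex \<open>i\<close> of the arm to its predecessor,
  \<open>VB\<close> preceding vertex 0, so vertices and edges of an arm share one index set.\<close>

definition arm_edge :: "(nat \<Rightarrow> vertex) \<Rightarrow> nat \<Rightarrow> vertex set" where
  "arm_edge f i = {if i = 0 then VB else f (i - 1), f i}"

definition cycle_graph :: "nat \<Rightarrow> vertex graph" where
  "cycle_graph c = (Cyc ` {..<c}, cycle_edge c ` {..<c})"

text \<open>Edge \<open>i\<close> is left out because its other end is not in the piece.\<close>

definition tail_graph :: "(nat \<Rightarrow> vertex) \<Rightarrow> nat \<Rightarrow> nat \<Rightarrow> vertex graph" where
  "tail_graph f i m = (f ` {i..<m}, arm_edge f ` {i<..<m})"

text \<open>All edges except the one joining \<open>VA\<close> and \<open>VB\<close>;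
  \<open>S\<close> records which cycle edges survive.\<close>

definition outer_edges :: "nat \<Rightarrow> nat set \<Rightarrow> nat \<Rightarrow> nat \<Rightarrow> vertex set set" where
  "outer_edges c S m k = cycle_edge c ` S \<union> arm_edge P ` {..<m} \<union> arm_edge Q ` {..<k}"

definition chomp_vertices :: "nat \<Rightarrow> nat \<Rightarrow> nat \<Rightarrow> vertex set" where
  "chomp_vertices c m k = insert VB (Cyc ` {..<c} \<union> P ` {..<m} \<union> Q ` {..<k})"

lemma arm_edges_eq:
  "(if 0 < m then {{VB, f 0}} else {}) \<union> {{f i, f (Suc i)} | i. Suc i < m} = arm_edge f ` {..<m}"
proof (cases m)
  case (Suc n)
  then show ?thesis unfolding Suc lessThan_Suc_eq_insert_0
    by (auto simp: arm_edge_def image_iff)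
qed simp

lemma chomp_graph_eq:
  "chomp_graph c m k = (chomp_vertices c m k, insert {VA, VB} (outer_edges c {..<c} m k))"
  unfolding chomp_graph_def chomp_vertices_def outer_edges_def arm_edges_eq[symmetric]
  by (auto simp: cycle_edge_def)

lemma cycle_edge_eq_iff:
  assumes "c \<ge> 3" "i < c" "j < c"
  shows "cycle_edge c i = cycle_edge c j \<longleftrightarrow> i = j"
proof -
  have "Suc i mod c = (if Suc i = c then 0 else Suc i)" "Suc j mod c = (if Suc j = c then 0 else Suc j)"
    using assms by auto
  then show ?thesis using assms by (auto simp: cycle_edge_def doubleton_eq_iff split: if_splits)
qed

lemma Cyc_in_cycle_edge:
  assumes "c \<ge> 3" "i < c" "j < c"
  shows "Cyc i \<in> cycle_edge c j \<longleftrightarrow> j = i \<or> j = (if i = 0 then c - 1 else i - 1)"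
proof -
  have "Suc j mod c = (if Suc j = c then 0 else Suc j)"
    using assms by auto
  then show ?thesis using assms by (auto simp: cycle_edge_def split: if_splits)
qed

lemma arm_edge_eq_iff [simp]:
  "arm_edge P i = arm_edge P j \<longleftrightarrow> i = j" "arm_edge Q i = arm_edge Q j \<longleftrightarrow> i = j"
  "arm_edge P i \<noteq> arm_edge Q j" "arm_edge Q i \<noteq> arm_edge P j"
  "arm_edge P i \<noteq> cycle_edge c j" "arm_edge Q i \<noteq> cycle_edge c j"
  "cycle_edge c j \<noteq> arm_edge P i" "cycle_edge c j \<noteq> arm_edge Q i"
  "arm_edge P i \<noteq> {VA, VB}" "arm_edge Q i \<noteq> {VA, VB}"
  "{VA, VB} \<noteq> arm_edge P i" "{VA, VB} \<noteq> arm_edge Q i"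
  "cycle_edge c j \<noteq> {VA, VB}" "{VA, VB} \<noteq> cycle_edge c j"
  by (auto simp: arm_edge_def cycle_edge_def doubleton_eq_iff)

lemma in_cycle_edge [simp]:
  "VB \<notin> cycle_edge c i" "P j \<notin> cycle_edge c i" "Q j \<notin> cycle_edge c i"
  by (auto simp: cycle_edge_def)

lemma in_arm_edge [simp]:
  "VB \<in> arm_edge P i \<longleftrightarrow> i = 0" "VB \<in> arm_edge Q i \<longleftrightarrow> i = 0"
  "Cyc j \<notin> arm_edge P i" "Cyc j \<notin> arm_edge Q i"
  "P j \<in> arm_edge P i \<longleftrightarrow> i = j \<or> i = Suc j" "Q j \<in> arm_edge Q i \<longleftrightarrow> i = j \<or> i = Suc j"
  "P j \<notin> arm_edge Q i" "Q j \<notin> arm_edge P i"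
  by (auto simp: arm_edge_def)

lemma card_outer_edges:
  assumes "c \<ge> 3" "S \<subseteq> {..<c}"
  shows "card (outer_edges c S m k) = card S + m + k"
    and "card (insert {VA, VB} (outer_edges c S m k)) = Suc (card S + m + k)"
proof -
  have "finite S" using assms(2) finite_subset by blast
  have "inj_on (cycle_edge c) S" "inj_on (arm_edge P) {..<m}" "inj_on (arm_edge Q) {..<k}"
    using assms by (auto simp: inj_on_def cycle_edge_eq_iff subset_iff)
  then show 1: "card (outer_edges c S m k) = card S + m + k"
    unfolding outer_edges_def using \<open>finite S\<close>
    by (subst card_Un_disjoint; (subst card_Un_disjoint)?) (auto simp: card_image)
  have "{VA, VB} \<notin> outer_edges c S m k" "finite (outer_edges c S m k)"
    using \<open>finite S\<close> by (simp_all add: outer_edges_def image_iff)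
  then show "card (insert {VA, VB} (outer_edges c S m k)) = Suc (card S + m + k)"
    using 1 by simp
qed

lemma card_chomp_vertices: "card (chomp_vertices c m k) = Suc (c + m + k)"
proof -
  have "inj_on Cyc {..<c}" "inj_on P {..<m}" "inj_on Q {..<k}" by (auto simp: inj_on_def)
  then have "card (Cyc ` {..<c} \<union> P ` {..<m} \<union> Q ` {..<k}) = c + m + k"
    by (subst card_Un_disjoint; (subst card_Un_disjoint)?) (auto simp: card_image)
  then show ?thesis unfolding chomp_vertices_def by (subst card_insert_disjoint) auto
qed

text \<open>On an odd cycle, switching the parity colouring after \<open>Cyc i\<close> leaves exactly the edge
  \<open>cycle_edge c i\<close> monochromatic.\<close>

definition colour_class :: "nat \<Rightarrow> vertex set" where
  "colour_class i = {Cyc x | x. (x \<le> i) = even x} \<union> {P x | x. even x} \<union> {Q x | x. even x}"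

lemma in_colour_class [simp]: "VA \<in> colour_class i" "VB \<notin> colour_class i"
  by (auto simp: colour_class_def)

lemma crosses_colour_class [simp]:
  "crosses (colour_class i) (arm_edge P j)" "crosses (colour_class i) (arm_edge Q j)"
  by (auto simp: colour_class_def arm_edge_def)

text \<open>Oddness of \<open>c\<close> matters for the closing edge \<open>j = c - 1\<close>: its
  end \<open>Cyc (c - 1)\<close> has an even index beyond \<open>i\<close> and lies outside the
  class, while \<open>VA\<close> lies inside.\<close>

lemma crosses_cycle_edge:
  assumes "odd c" "i < c" "j < c" "i \<noteq> j"
  shows "crosses (colour_class i) (cycle_edge c j)"
proof -
  have "Suc j mod c = (if Suc j = c then 0 else Suc j)" using assms by auto
  then show ?thesis using assms by (auto simp: colour_class_def cycle_edge_def)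
qed

lemma crosses_outer_edges:
  assumes "odd c" "i < c" "e \<in> insert {VA, VB} (outer_edges c ({..<c} - {i}) m k)"
  shows "crosses (colour_class i) e"
  using assms crosses_cycle_edge[OF assms(1,2)] by (auto simp: outer_edges_def)

lemma outer_edges_mono: "S \<subseteq> T \<Longrightarrow> outer_edges c S m k \<subseteq> outer_edges c T m k"
  by (auto simp: outer_edges_def)

text \<open>Once the cycle is broken, counting vertices and edges suffices, whether or not the
  position is connected.\<close>

lemma nim_value_without_cycle_edge:
  assumes "odd c" "i < c" "finite_simple_graph (V, E)"
    "E \<subseteq> insert {VA, VB} (outer_edges c ({..<c} - {i}) m k)"
  shows "nim_value (V, E) = card V mod 2 + 2 * (card E mod 2)"
proof -
  have "crosses (colour_class i) e" if "e \<in> E" for e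
    using that assms(4) by (intro crosses_outer_edges[OF assms(1,2)]) blast
  then show ?thesis
    using nim_value_bipartite[OF assms(3), of "colour_class i"] by (simp add: parity_value_def)
qed

section \<open>Values of paths and of the odd cycle\<close>

lemma finite_simple_delete:
  assumes "finite_simple_graph G"
  shows "e \<in> snd G \<Longrightarrow> finite_simple_graph (delete_edge G e)"
    "v \<in> fst G \<Longrightarrow> finite_simple_graph (delete_vertex G v)"
  using finite_simple_graph_chomp_moves[OF assms] by (auto simp: chomp_moves_def)

lemma finite_simple_cycle_graph: 
  assumes "c \<ge> 3"
  shows "finite_simple_graph (cycle_graph c)"
proof -
  have "i \<noteq> Suc i mod c" if "i < c" for i
    using that assms by (cases "Suc i = c") auto
  then show ?thesis using assms by (auto simp: finite_simple_graph_def cycle_graph_def cycle_edge_def)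
qed

lemma finite_simple_tail_graph: 
  assumes "f = P \<or> f = Q"
  shows "finite_simple_graph (tail_graph f i m)"
  using assms by (auto simp: finite_simple_graph_def tail_graph_def arm_edge_def intro!: imageI)

lemma nim_value_tail_graph:
  assumes "f = P \<or> f = Q"
  shows "nim_value (tail_graph f i m) = tail_value (m - i)"
proof -
  have "inj_on f {i..<m}" "inj_on (arm_edge f) {i<..<m}"
    using assms by (auto simp: inj_on_def)
  then have "card (fst (tail_graph f i m)) = m - i" "card (snd (tail_graph f i m)) = m - Suc i"
    by (simp_all add: tail_graph_def card_image)
  moreover have "nim_value (tail_graph f i m) = parity_value (tail_graph f i m)"
    using finite_simple_tail_graph[OF assms] assms
    by (intro nim_value_bipartite[of _ "colour_class 0"]) (auto simp: tail_graph_def)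
  moreover have "odd (m - i) = even (m - Suc i)" if "i < m"
    using that by (metis Suc_diff_Suc even_Suc)
  ultimately show ?thesis
    by (auto simp: parity_value_def tail_value_def mod_2_eq_odd not_less)
qed

lemma cycle_edges_avoiding:
  assumes "c \<ge> 3" "i < c"
  shows "{e \<in> cycle_edge c ` {..<c}. Cyc i \<notin> e}
    = cycle_edge c ` ({..<c} - {i, if i = 0 then c - 1 else i - 1})"
  using Cyc_in_cycle_edge[OF assms] by (auto simp: image_iff)

lemma card_cycle_avoiding:
  assumes "c \<ge> 3" "i < c"
  shows "card ({..<c} - {i, if i = 0 then c - 1 else i - 1}) = c - 2"
proof -
  define j where "j = (if i = 0 then c - 1 else i - 1)"
  have "j < c" "i \<noteq> j" using assms by (auto simp: j_def)
  then have "card ({..<c} - {i, j}) = c - 2"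
    using assms by (subst card_Diff_subset) auto
  then show ?thesis by (simp add: j_def)
qed

lemma outer_edges_arms_empty: "outer_edges c S 0 0 = cycle_edge c ` S"
  by (simp add: outer_edges_def)

text \<open>No option has value 0: deleting an edge leaves \<open>c\<close> vertices and
  \<open>c - 1\<close> edges, of value 1; deleting a vertex leaves \<open>c - 1\<close> vertices and
  \<open>c - 2\<close> edges, of value 2.\<close>

lemma nim_value_cycle_graph:
  assumes "odd c" "c \<ge> 3"
  shows "nim_value (cycle_graph c) = 0"
proof -
  note fin = finite_simple_cycle_graph[OF assms(2)]
  have "nim_value H \<noteq> 0" if "H \<in> chomp_moves (cycle_graph c)" for H
  proof -
    have cV: "card (Cyc ` {..<c}) = c" by (simp add: card_image inj_on_def)
    from that consider i where "i < c" "H = delete_edge (cycle_graph c) (cycle_edge c i)"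
      | i where "i < c" "H = delete_vertex (cycle_graph c) (Cyc i)"
      by (auto simp: chomp_moves_def cycle_graph_def)
    then show ?thesis
    proof cases
      case 1
      have H: "H = (Cyc ` {..<c}, outer_edges c ({..<c} - {i}) 0 0)"
        unfolding 1(2) using cycle_edge_eq_iff[OF assms(2) _ 1(1)] 1(1)
        by (auto simp: delete_edge_def cycle_graph_def outer_edges_arms_empty)
      have "finite_simple_graph H"
        unfolding 1(2) by (rule finite_simple_delete[OF fin]) (use 1 in \<open>simp add: cycle_graph_def\<close>)
      then show ?thesis
        using nim_value_without_cycle_edge[OF assms(1) 1(1), of "fst H" "snd H" 0 0] assms(1) cV
          card_outer_edges(1)[OF assms(2), of "{..<c} - {i}" 0 0] 1(1)
        by (auto simp: H mod_2_eq_odd subset_insertI)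
    next
      case 2
      define T where "T = {..<c} - {i, if i = 0 then c - 1 else i - 1}"
      have H: "H = (Cyc ` {..<c} - {Cyc i}, outer_edges c T 0 0)"
        unfolding 2(2) T_def delete_vertex_def cycle_graph_def outer_edges_arms_empty
        using cycle_edges_avoiding[OF assms(2) 2(1)] by simp
      have T: "T \<subseteq> {..<c} - {i}" "card T = c - 2"
        using card_cycle_avoiding[OF assms(2) 2(1)] by (auto simp: T_def)
      have "finite_simple_graph H"
        unfolding 2(2) by (rule finite_simple_delete[OF fin]) (use 2 in \<open>simp add: cycle_graph_def\<close>)
      moreover have "card (outer_edges c T 0 0) = c - 2"
        using card_outer_edges(1)[OF assms(2), of T 0 0] T by auto
      moreover have "outer_edges c T 0 0 \<subseteq> insert {VA, VB} (outer_edges c ({..<c} - {i}) 0 0)"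
        using outer_edges_mono[OF T(1)] by blast
      ultimately show ?thesis
        using nim_value_without_cycle_edge[OF assms(1) 2(1), of "fst H" "snd H" 0 0] assms cV 2(1)
        by (auto simp: H mod_2_eq_odd)
    qed
  qed
  then have "0 \<notin> nim_value ` chomp_moves (cycle_graph c)" by (metis imageE)
  then have "mex (nim_value ` chomp_moves (cycle_graph c)) = 0" by (intro mex_eqI) simp_all
  then show ?thesis using nim_value_rec[OF fin] by simp
qed

section \<open>Options of the cycle with two arms\<close>

context
  fixes c :: nat
  assumes c: "odd c" "c \<ge> 3"
begin

lemma nim_value_delete_cycle_edge:
  assumes "i < c"
  shows "nim_value (delete_edge (chomp_graph c m k) (cycle_edge c i)) = (if even (m + k) then 2 else 1)"
proof -
  let ?E = "insert {VA, VB} (outer_edges c ({..<c} - {i}) m k)"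
  have eq: "delete_edge (chomp_graph c m k) (cycle_edge c i) = (chomp_vertices c m k, ?E)"
    using cycle_edge_eq_iff[OF c(2) _ assms] assms
    by (auto simp: delete_edge_def chomp_graph_eq outer_edges_def)
  have "finite_simple_graph (chomp_vertices c m k, ?E)"
    unfolding eq[symmetric]
    by (rule finite_simple_delete[OF finite_simple_graph_chomp_graph[OF c(2)]])
       (use assms in \<open>simp add: chomp_graph_eq outer_edges_def\<close>)
  from nim_value_without_cycle_edge[OF c(1) assms this order_refl] show ?thesis
    using assms c card_outer_edges(2)[OF c(2), of "{..<c} - {i}" m k]
    by (simp add: eq card_chomp_vertices mod_2_eq_odd)
qed

lemma nim_value_delete_Cyc:
  assumes "i < c"
  shows "nim_value (delete_vertex (chomp_graph c m k) (Cyc i)) =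
    (if i = 0 then (if even (m + k) then 3 else 0) else if even (m + k) then 1 else 2)"
proof -
  define T where "T = {..<c} - {i, if i = 0 then c - 1 else i - 1}"
  have T: "T \<subseteq> {..<c} - {i}" "card T = c - 2" "T \<subseteq> {..<c}"
    using card_cycle_avoiding[OF c(2) assms] by (auto simp: T_def)
  let ?V = "chomp_vertices c m k - {Cyc i}"
  \<comment> \<open>Deleting \<open>VA\<close> also removes its edge to \<open>VB\<close>, which
    changes the edge parity.\<close>
  define E where "E = (if i = 0 then outer_edges c T m k else insert {VA, VB} (outer_edges c T m k))"
  have "{e \<in> A \<union> B \<union> D. Cyc i \<notin> e} = {e \<in> A. Cyc i \<notin> e} \<union> B \<union> D"
    if "\<forall>e\<in>B. Cyc i \<notin> e" "\<forall>e\<in>D. Cyc i \<notin> e" for A B D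
    using that by blast
  then have "{e \<in> outer_edges c {..<c} m k. Cyc i \<notin> e} = outer_edges c T m k"
    unfolding outer_edges_def T_def cycle_edges_avoiding[OF c(2) assms, symmetric] by simp
  then have eq: "delete_vertex (chomp_graph c m k) (Cyc i) = (?V, E)"
    by (auto simp: delete_vertex_def chomp_graph_eq E_def)
  have mem: "Cyc i \<in> chomp_vertices c m k" "finite (chomp_vertices c m k)"
    using assms by (auto simp: chomp_vertices_def)
  have "finite_simple_graph (?V, E)"
    unfolding eq[symmetric]
    by (rule finite_simple_delete[OF finite_simple_graph_chomp_graph[OF c(2)]])
       (use mem in \<open>simp add: chomp_graph_eq\<close>)
  moreover have "E \<subseteq> insert {VA, VB} (outer_edges c ({..<c} - {i}) m k)"
    using outer_edges_mono[OF T(1), of c m k] by (auto simp: E_def)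
  ultimately have "nim_value (?V, E) = card ?V mod 2 + 2 * (card E mod 2)"
    by (rule nim_value_without_cycle_edge[OF c(1) assms])
  moreover have "card ?V = c + m + k" using mem by (simp add: card_chomp_vertices)
  moreover have "card E = (if i = 0 then 0 else 1) + (c - 2 + m + k)"
    using card_outer_edges[OF c(2) T(3), of m k] T(2) by (simp add: E_def)
  ultimately show ?thesis using c by (simp add: eq mod_2_eq_odd)
qed

text \<open>The cycle stays intact, so the parity formula does not apply to the whole. It splits off
  with value 0 and leaves a path with \<open>m + k + 1\<close> vertices and \<open>m + k\<close>
  edges.\<close>

lemma nim_value_delete_AB:
  "nim_value (delete_edge (chomp_graph c m k) {VA, VB}) = (if even (m + k) then 1 else 2)"
proof -
  let ?T = "(insert VB (P ` {..<m} \<union> Q ` {..<k}), outer_edges c {} m k)"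
  have eq: "delete_edge (chomp_graph c m k) {VA, VB} = graph_union (cycle_graph c) ?T"
  proof -
    have "{VA, VB} \<notin> outer_edges c {..<c} m k" by (simp add: outer_edges_def image_iff)
    then show ?thesis
      by (simp add: delete_edge_def chomp_graph_eq graph_union_def cycle_graph_def chomp_vertices_def)
         (simp add: outer_edges_def Un_assoc)
  qed
  have fin: "finite_simple_graph ?T"
    by (auto simp: finite_simple_graph_def outer_edges_def arm_edge_def)
  have "card (P ` {..<m} \<union> Q ` {..<k}) = m + k"
    by (subst card_Un_disjoint) (auto simp: card_image inj_on_def)
  then have V: "card (fst ?T) = Suc (m + k)" by (simp, subst card_insert_disjoint) auto
  have "outer_edges c {} m k \<subseteq> outer_edges c ({..<c} - {0}) m k" by (rule outer_edges_mono) simp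
  then have "nim_value ?T = card (fst ?T) mod 2 + 2 * (card (snd ?T) mod 2)"
    using nim_value_without_cycle_edge[OF c(1) _ fin, of 0 m k] c by auto
  also have "\<dots> = (if even (m + k) then 1 else 2)"
    unfolding V using card_outer_edges(1)[OF c(2), of "{}" m k] by (simp add: mod_2_eq_odd)
  finally show ?thesis
    unfolding eq
    by (subst nim_value_graph_union[OF finite_simple_cycle_graph[OF c(2)] fin])
       (auto simp: cycle_graph_def nim_value_cycle_graph[OF c, unfolded cycle_graph_def])
qed

lemma nim_value_delete_VB:
  "nim_value (delete_vertex (chomp_graph c m k) VB) = tail_value m XOR tail_value k"
proof -
  have eq: "delete_vertex (chomp_graph c m k) VB =
      graph_union (cycle_graph c) (graph_union (tail_graph P 0 m) (tail_graph Q 0 k))"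
    by (auto simp: delete_vertex_def chomp_graph_eq graph_union_def cycle_graph_def outer_edges_def
        chomp_vertices_def tail_graph_def)
  have fin: "finite_simple_graph (tail_graph P 0 m)" "finite_simple_graph (tail_graph Q 0 k)"
    by (simp_all add: finite_simple_tail_graph)
  have disj: "fst (tail_graph P 0 m) \<inter> fst (tail_graph Q 0 k) = {}"
    "fst (cycle_graph c) \<inter> fst (graph_union (tail_graph P 0 m) (tail_graph Q 0 k)) = {}"
    by (auto simp: tail_graph_def graph_union_def cycle_graph_def)
  show ?thesis
    unfolding eq nim_value_graph_union[OF finite_simple_cycle_graph[OF c(2)] finite_simple_graph_union[OF fin] disj(2)]
      nim_value_graph_union[OF fin disj(1)]
    by (simp add: nim_value_cycle_graph[OF c] nim_value_tail_graph)
qed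

text \<open>For \<open>Q\<close> the two lengths are exchanged, so that \<open>m\<close> is always
  the length of the arm being cut.\<close>

lemma delete_arm:
  assumes "i < m"
  shows "delete_edge (chomp_graph c m k) (arm_edge P i) = graph_union (chomp_graph c i k) (tail_graph P i m)"
    and "delete_edge (chomp_graph c k m) (arm_edge Q i) = graph_union (chomp_graph c k i) (tail_graph Q i m)"
    and "delete_vertex (chomp_graph c m k) (P i) = graph_union (chomp_graph c i k) (tail_graph P (Suc i) m)"
    and "delete_vertex (chomp_graph c k m) (Q i) = graph_union (chomp_graph c k i) (tail_graph Q (Suc i) m)"
proof -
  \<comment> \<open>Deleting edge \<open>i\<close> removes one edge index; deleting vertex
    \<open>i\<close> removes the edge indices \<open>i\<close> and \<open>Suc i\<close>, the latter
    possibly beyond the end of the arm.\<close>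
  have split: "{..<m} = {..<i} \<union> {i..<m}" "{..<m} - {i} = {..<i} \<union> {i<..<m}"
    "{..<m} - {i, Suc i} = {..<i} \<union> {Suc i<..<m}" "{..<m} - {i} = {..<i} \<union> {Suc i..<m}" using assms by auto
  have vertices: "chomp_vertices c m k = chomp_vertices c i k \<union> P ` {i..<m}"
    "chomp_vertices c k m = chomp_vertices c k i \<union> Q ` {i..<m}"
    unfolding chomp_vertices_def split(1) by auto
  have "arm_edge f ` {..<m} - {arm_edge f i} = arm_edge f ` {..<i} \<union> arm_edge f ` {i<..<m}"
    if "f = P \<or> f = Q" for f
    unfolding image_Un[symmetric] split(2)[symmetric] using that by auto
  note edges = this[of P] this[of Q]
  have "{e \<in> arm_edge P ` {..<m}. P i \<notin> e} = arm_edge P ` {..<i} \<union> arm_edge P ` {Suc i<..<m}"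
    "{e \<in> arm_edge Q ` {..<m}. Q i \<notin> e} = arm_edge Q ` {..<i} \<union> arm_edge Q ` {Suc i<..<m}"
    unfolding image_Un[symmetric] split(3)[symmetric] by auto
  note avoid = this
  have "chomp_vertices c m k - {P i} = chomp_vertices c i k \<union> P ` {Suc i..<m}"
    "chomp_vertices c k m - {Q i} = chomp_vertices c k i \<union> Q ` {Suc i..<m}"
    using split(4) by (auto simp: chomp_vertices_def)
  note vs = this
  have notin: "arm_edge P i \<notin> cycle_edge c ` S" "arm_edge Q i \<notin> cycle_edge c ` S"
    "arm_edge P i \<notin> arm_edge Q ` S'" "arm_edge Q i \<notin> arm_edge P ` S'" for S S'
    by (simp_all add: image_iff)
  show "delete_edge (chomp_graph c m k) (arm_edge P i) = graph_union (chomp_graph c i k) (tail_graph P i m)"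
    "delete_edge (chomp_graph c k m) (arm_edge Q i) = graph_union (chomp_graph c k i) (tail_graph Q i m)"
    unfolding delete_edge_def chomp_graph_eq graph_union_def tail_graph_def vertices outer_edges_def
    using edges notin by (simp_all add: insert_Diff_if Un_Diff Un_ac)
  have avoid_insert: "{e \<in> insert {VA, VB} (A \<union> B \<union> D). v \<notin> e}
      = insert {VA, VB} ({e \<in> A. v \<notin> e} \<union> {e \<in> B. v \<notin> e} \<union> {e \<in> D. v \<notin> e})"
    if "v \<noteq> VA" "v \<noteq> VB" for A B D v
    using that by blast
  have avoid': "{e \<in> cycle_edge c ` S. P i \<notin> e} = cycle_edge c ` S" "{e \<in> cycle_edge c ` S. Q i \<notin> e} = cycle_edge c ` S"
    "{e \<in> arm_edge Q ` S'. P i \<notin> e} = arm_edge Q ` S'" "{e \<in> arm_edge P ` S'. Q i \<notin> e} = arm_edge P ` S'" for S S'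
    by auto
  show "delete_vertex (chomp_graph c m k) (P i) = graph_union (chomp_graph c i k) (tail_graph P (Suc i) m)"
    "delete_vertex (chomp_graph c k m) (Q i) = graph_union (chomp_graph c k i) (tail_graph Q (Suc i) m)"
    unfolding delete_vertex_def chomp_graph_eq graph_union_def tail_graph_def outer_edges_def
    by (simp_all only: fst_conv snd_conv avoid_insert vertex.distinct not_False_eq_True avoid avoid' vs)
       (simp_all add: Un_ac)
qed

text \<open>Deleting an edge leads to \<open>j = i\<close> and deleting a vertex to
  \<open>j = Suc i\<close>.\<close>

lemma nim_value_chomp_with_tail:
  assumes "i \<le> j"
  shows "nim_value (graph_union (chomp_graph c i k) (tail_graph P j m))
      = nim_value (chomp_graph c i k) XOR tail_value (m - j)"
    and "nim_value (graph_union (chomp_graph c k i) (tail_graph Q j m))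
      = nim_value (chomp_graph c k i) XOR tail_value (m - j)"
proof -
  have "fst (chomp_graph c i k) \<inter> fst (tail_graph P j m) = {}"
    "fst (chomp_graph c k i) \<inter> fst (tail_graph Q j m) = {}"
    using assms by (auto simp: chomp_graph_eq tail_graph_def chomp_vertices_def)
  then show "nim_value (graph_union (chomp_graph c i k) (tail_graph P j m))
      = nim_value (chomp_graph c i k) XOR tail_value (m - j)"
    and "nim_value (graph_union (chomp_graph c k i) (tail_graph Q j m))
      = nim_value (chomp_graph c k i) XOR tail_value (m - j)"
    by (simp_all add: nim_value_graph_union finite_simple_graph_chomp_graph[OF c(2)]
        finite_simple_tail_graph nim_value_tail_graph)
qed

lemma nim_value_chomp_graph_rec:
  "nim_value (chomp_graph c m k) =
    mex (core_values m k \<union> arm_values (\<lambda>u. nim_value (chomp_graph c u k)) m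
      \<union> arm_values (\<lambda>u. nim_value (chomp_graph c m u)) k)"
proof -
  let ?G = "chomp_graph c m k"
  let ?cyc = "if even (m + k) then 1 else 2 :: nat"
  \<comment> \<open>\<open>VA\<close> is singled out because its deletion differs in value from that
    of the other cycle vertices.\<close>
  have V: "fst ?G = insert VB (insert VA (Cyc ` {0<..<c} \<union> P ` {..<m} \<union> Q ` {..<k}))"
  proof -
    have "{..<c} = insert 0 {0<..<c}" using c(2) by auto
    then show ?thesis by (auto simp: chomp_graph_eq chomp_vertices_def)
  qed
  have E: "snd ?G = insert {VA, VB} (cycle_edge c ` {..<c} \<union> arm_edge P ` {..<m} \<union> arm_edge Q ` {..<k})"
    by (simp add: chomp_graph_eq outer_edges_def)
  \<comment> \<open>The images under constant functions below are singletons only for nonempty index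
    sets.\<close>
  have "0 \<in> {..<c}" "1 \<in> {0<..<c}" using c(2) by auto
  then have ne: "{..<c} \<noteq> {}" "{0<..<c} \<noteq> {}" "0 < c" by auto
  have 1: "nim_value ` delete_edge ?G ` cycle_edge c ` {..<c} = {if even (m + k) then 2 else 1}"
    using ne(1) by (simp add: image_image nim_value_delete_cycle_edge image_constant_conv)
  have 2: "nim_value ` delete_vertex ?G ` Cyc ` {0<..<c} = {?cyc}"
    using ne(2) by (simp add: image_image nim_value_delete_Cyc image_constant_conv)
  have 3: "nim_value ` delete_edge ?G ` arm_edge P ` {..<m} \<union> nim_value ` delete_vertex ?G ` P ` {..<m}
      = arm_values (\<lambda>u. nim_value (chomp_graph c u k)) m"
    unfolding arm_values_eq_image by (simp add: image_image delete_arm nim_value_chomp_with_tail)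
  have 4: "nim_value ` delete_edge ?G ` arm_edge Q ` {..<k} \<union> nim_value ` delete_vertex ?G ` Q ` {..<k}
      = arm_values (\<lambda>u. nim_value (chomp_graph c m u)) k"
    unfolding arm_values_eq_image by (simp add: image_image delete_arm nim_value_chomp_with_tail)
  have "nim_value ` chomp_moves ?G = core_values m k
      \<union> arm_values (\<lambda>u. nim_value (chomp_graph c u k)) m
      \<union> arm_values (\<lambda>u. nim_value (chomp_graph c m u)) k"
    unfolding chomp_moves_def V E image_Un image_insert 1 2 3[symmetric] 4[symmetric]
      nim_value_delete_AB nim_value_delete_VB nim_value_delete_Cyc[OF ne(3)]
    by (auto simp: core_values_def)
  then show ?thesis using nim_value_rec[OF finite_simple_graph_chomp_graph[OF c(2)]] by metis
qed

end

theorem theorem5: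
  fixes c a b i j n :: nat
  assumes "odd c" and "c \<ge> 3"
    and "i \<in> {1, 2, 3}" and "j \<in> {1, 2, 3}"
    and "n = (a XOR b) + 1"
  shows "nim_value (chomp_graph c (3 * a + i) (3 * b + j)) =
    (if (i = 2) \<noteq> (j = 2) then 4 * n + 2 else 4 * n)"
proof -
  \<comment> \<open>After this shift \<open>i'\<close> and \<open>j'\<close> are residues modulo 3,
    and the middle position 2 becomes the residue 1 of \<open>block_value\<close>.\<close>
  define i' j' where "i' = i - 1" and "j' = j - 1"
  have i: "i = Suc i'" "i' < 3" and j: "j = Suc j'" "j' < 3"
    using assms(3,4) by (auto simp: i'_def j'_def)
  have "nim_value (chomp_graph c (Suc (3 * a + i')) (Suc (3 * b + j')))
      = block_value (3 * a + i') (3 * b + j')"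
    by (rule recurrence_solution) (rule nim_value_chomp_graph_rec[OF assms(1,2)])
  then show ?thesis using i j assms(5) by (simp add: block_value_def)
qed

end
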